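(* Let $G=\mathbb{Z}^d\times G_0$ where $d$ is a natural number and $G_0=(G_0,+)$ is a finite abelian group (every finitely generated abelian group is of this form up to isomorphism). Let $F$ be a finite subset of $G$. Then the following are equivalent: (i) There exists a factor of iid tiling $F\oplus A=G$ of $G$ by $F$. (ii) $F$ is of the form $F=\{x_0\}\times F_0$ for some $x_0\in\mathbb{Z}^d$ and $F_0\subset G_0$, such that $G_0$ admits a tiling $F_0\oplus A_0=G_0$ by $F_0$ (for some $A_0\subset G_0$).
   Context: For an abelian group $H=(H,+)$, a finite set $F\subset H$ and a set $A\subset H$, $F\oplus A=H$ means that the translates $f+A=\{f+a:a\in A\}$, $f\in F$, partition $H$. Factor of iid: let $(\lambda(x))_{x\in G}$ be jointly independent random variables, each uniformly distributed on $[0,1]$. A random subset $A$ of $G$ is a factor of iid process if there exists a Borel measurable function $\Phi\colon[0,1]^G\to\{0,1\}$ such that, almost surely, $\mathbf{1}_A(x_0)=\Phi\big((\lambda(x_0+x))_{x\in G}\big)$ for all $x_0\in G$. A factor of iid tiling of $G$ by a finite set $F\subset G$ is a factor of iid process $A$ such that $F\oplus A=G$ almost surely. *)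

theory Defs
  imports "HOL-Probability.Probability" "HOL-Algebra.Algebra"
begin

text \<open>
  Abelian groups are \<^locale>\<open>comm_group\<close> structures, written multiplicatively:
  \<open>f <#\<^bsub>H\<^esub> A\<close> is the translate \<open>f + A\<close>.
\<close>

definition tiling :: "('a, 'b) monoid_scheme \<Rightarrow> 'a set \<Rightarrow> 'a set \<Rightarrow> bool"
  where "tiling H F A \<longleftrightarrow>
    F \<subseteq> carrier H \<and> A \<subseteq> carrier H \<and>
    disjoint_family_on (\<lambda>f. f <#\<^bsub>H\<^esub> A) F \<and>
    (\<Union>f\<in>F. f <#\<^bsub>H\<^esub> A) = carrier H"

text \<open>
  \<open>\<int>\<^sup>d\<close>, with \<open>d = 0\<close> allowed; its elements are the functions \<open>nat \<Rightarrow> int\<close> that are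
  \<open>undefined\<close> outside \<open>{..<d}\<close>.
\<close>

definition lattice_group :: "nat \<Rightarrow> (nat \<Rightarrow> int) monoid"
  where "lattice_group d = product_group {..<d} (\<lambda>_. integer_group)"

definition iid_uniform :: "'w measure \<Rightarrow> 'a set \<Rightarrow> ('a \<Rightarrow> 'w \<Rightarrow> real) \<Rightarrow> bool"
  where "iid_uniform M I lam \<longleftrightarrow>
    prob_space M \<and>
    prob_space.indep_vars M (\<lambda>_. borel) lam I \<and>
    (\<forall>x\<in>I. distr M borel (lam x) = uniform_measure lborel {0..1})"

definition random_subset :: "'w measure \<Rightarrow> 'a set \<Rightarrow> ('w \<Rightarrow> 'a set) \<Rightarrow> bool"
  where "random_subset M I A \<longleftrightarrow>
    (\<forall>w\<in>space M. A w \<subseteq> I) \<and> (\<forall>x\<in>I. {w \<in> space M. x \<in> A w} \<in> sets M)"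

text \<open>
  The product \<open>\<sigma>\<close>-algebra on \<open>[0,1]\<^sup>G\<close> used below is the Borel one whenever \<open>G\<close> is countable.
  The variables \<open>lam x\<close> need only lie in \<open>[0,1]\<close> almost surely; for countable \<open>G\<close> the exceptional
  outcomes form a null set, which the almost-sure quantifier absorbs.
\<close>

definition factor_of_iid ::
  "'w measure \<Rightarrow> ('a, 'b) monoid_scheme \<Rightarrow> ('a \<Rightarrow> 'w \<Rightarrow> real) \<Rightarrow> ('w \<Rightarrow> 'a set) \<Rightarrow> bool"
  where "factor_of_iid M G lam A \<longleftrightarrow>
    random_subset M (carrier G) A \<and>
    (\<exists>\<Phi> \<in> (\<Pi>\<^sub>M x\<in>carrier G. restrict_space borel {0..1}) \<rightarrow>\<^sub>M count_space {0, 1 :: nat}.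
      AE w in M. \<forall>x0\<in>carrier G.
        indicator (A w) x0 = \<Phi> (\<lambda>x\<in>carrier G. lam (x0 \<otimes>\<^bsub>G\<^esub> x) w))"

definition factor_of_iid_tiling ::
  "'w measure \<Rightarrow> ('a, 'b) monoid_scheme \<Rightarrow> ('a \<Rightarrow> 'w \<Rightarrow> real) \<Rightarrow> 'a set \<Rightarrow> ('w \<Rightarrow> 'a set) \<Rightarrow> bool"
  where "factor_of_iid_tiling M G lam F A \<longleftrightarrow>
    factor_of_iid M G lam A \<and> (AE w in M. tiling G F (A w))"

end

theory Submission
  imports Defs "HOL-Number_Theory.Residues"
begin

text \<open>
  Let \<open>F \<oplus> A = G\<close> be a factor of iid tiling, written \<open>1\<^sub>F * 1\<^sub>A = 1\<close>. The proof that \<open>F\<close> lies in one fibre sets an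
  arithmetic rigidity of tilings against the independence at large distances in a factor of iid.
  
  The rigidity is the dilation lemma (\<open>dilate_prime_power\<close>): if \<open>p > card F\<close> is prime, then
  \<open>A\<close> is also a tiling complement of \<open>p\<^sup>k F\<close> for every \<open>k\<close>, because the \<open>p\<close>-th convolution power of
  \<open>1\<^sub>F\<close> is the indicator of \<open>p F\<close> modulo \<open>p\<close>, counted with multiplicity. In particular, for distinct
  \<open>f, f' \<in> F\<close> the random set \<open>A\<close> almost surely does not contain both \<open>- p\<^sup>k f\<close> and \<open>- p\<^sup>k f'\<close>. If \<open>f' - f\<close> has
  infinite order, the difference of these two points leaves every finite set as \<open>k\<close> grows. Events determined by iid variables are mixing
  (\<open>iid_mixing\<close>), so the probability that \<open>A\<close> contains both points comes close to the square of the density of \<open>A\<close>, which is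
  positive: a contradiction. Hence \<open>f' - f\<close> has finite order
  (\<open>factor_of_iid_tile_differences_torsion\<close>). Since \<open>\<int>\<^sup>d\<close> is torsion-free, all elements of \<open>F\<close> have the same component in
  \<open>\<int>\<^sup>d\<close>, and almost every realization of \<open>A\<close>, restricted to a fibre, gives the tiling of \<open>G\<^sub>0\<close>
  (\<open>tiling_single_fibre_iff\<close>).
  
  Conversely, given \<open>F\<^sub>0 \<oplus> A\<^sub>0 = G\<^sub>0\<close>, the finite fibres can be treated separately: in each of them
  the point with the smallest label serves as a random origin at which a copy of \<open>A\<^sub>0\<close> is placed
  (\<open>single_fibre_factor_of_iid_tiling\<close>).
\<close>

section \<open>Frobenius congruence for commuting operators\<close>

text \<open>
  Convolution with \<open>1\<^sub>F\<close> is a sum of commuting translation operators. Working with operators on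
  integer-valued functions gives the identity \<open>(x + y)\<^sup>p \<equiv> x\<^sup>p + y\<^sup>p\<close> modulo \<open>p\<close> that one would otherwise
  take from the group ring of \<open>G\<close>.
\<close>

definition linear_op :: "(('x \<Rightarrow> int) \<Rightarrow> 'x \<Rightarrow> int) \<Rightarrow> bool"
  where "linear_op S \<longleftrightarrow> (\<forall>a b. S (\<lambda>x. a x + b x) = (\<lambda>x. S a x + S b x)) \<and>
    (\<forall>c a. S (\<lambda>x. c * a x) = (\<lambda>x. c * S a x))"

lemma linear_op_add: "linear_op S \<Longrightarrow> S (\<lambda>x. a x + b x) = (\<lambda>x. S a x + S b x)"
  by (simp add: linear_op_def)

lemma linear_op_scale: "linear_op S \<Longrightarrow> S (\<lambda>x. c * a x) = (\<lambda>x. c * S a x)"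
  by (simp add: linear_op_def)

lemma linear_op_zero: "linear_op S \<Longrightarrow> S (\<lambda>x. 0) = (\<lambda>x. 0)"
  using linear_op_scale[of S 0 "\<lambda>x. 0"] by simp

lemma linear_op_sum:
  assumes "linear_op S" "finite J"
  shows "S (\<lambda>x. \<Sum>j\<in>J. c j * b j x) = (\<lambda>x. \<Sum>j\<in>J. c j * S (b j) x)"
  using assms(2)
proof (induction J)
  case empty
  show ?case by (simp add: linear_op_zero[OF assms(1)])
next
  case (insert j J)
  then have "S (\<lambda>x. \<Sum>i\<in>insert j J. c i * b i x) = S (\<lambda>x. c j * b j x + (\<Sum>i\<in>J. c i * b i x))"
    by simp
  also have "\<dots> = (\<lambda>x. S (\<lambda>x. c j * b j x) x + S (\<lambda>x. \<Sum>i\<in>J. c i * b i x) x)"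
    by (rule linear_op_add[OF assms(1)])
  also have "S (\<lambda>x. c j * b j x) = (\<lambda>x. c j * S (b j) x)"
    by (rule linear_op_scale[OF assms(1)])
  finally show ?case using insert by simp
qed

text \<open>
  Pascal's rule in the form in which it enters the induction step of the binomial theorem: \<open>f k m\<close>
  plays the role of the monomial \<open>S\<^sup>k T\<^sup>m\<close>.
\<close>

lemma pascal_sum:
  fixes f :: "nat \<Rightarrow> nat \<Rightarrow> int"
  shows "(\<Sum>k\<le>n. int (n choose k) * f (Suc k) (n - k)) + (\<Sum>k\<le>n. int (n choose k) * f k (Suc (n - k)))
    = (\<Sum>k\<le>Suc n. int (Suc n choose k) * f k (Suc n - k))"
proof -
  have "(\<Sum>k\<le>n. int (n choose k) * f k (Suc (n - k))) =
      (\<Sum>k\<le>Suc n. int (n choose k) * f k (Suc n - k))"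
    by (simp add: Suc_diff_le binomial_eq_0)
  also have "\<dots> = f 0 (Suc n) + (\<Sum>k\<le>n. int (n choose Suc k) * f (Suc k) (n - k))"
    by (subst sum.atMost_Suc_shift) simp
  finally have 1: "(\<Sum>k\<le>n. int (n choose k) * f k (Suc (n - k))) = \<dots>" .
  have "(\<Sum>k\<le>Suc n. int (Suc n choose k) * f k (Suc n - k)) =
      f 0 (Suc n) + (\<Sum>k\<le>n. int (Suc n choose Suc k) * f (Suc k) (n - k))"
    by (subst sum.atMost_Suc_shift) simp
  also have "\<dots> = f 0 (Suc n) + (\<Sum>k\<le>n. int (n choose Suc k) * f (Suc k) (n - k))
      + (\<Sum>k\<le>n. int (n choose k) * f (Suc k) (n - k))"
    by (simp add: algebra_simps sum.distrib)
  finally show ?thesis using 1 by simp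
qed

lemma funpow_commute:
  assumes "\<And>a. S (T a) = T (S a)"
  shows "T ((S ^^ k) a) = (S ^^ k) (T a)"
  by (induction k) (simp_all add: assms[symmetric])

lemma funpow_add_commuting:
  assumes S: "linear_op S" and T: "linear_op T" and ST: "\<And>a. S (T a) = T (S a)"
  shows "((\<lambda>a x. S a x + T a x) ^^ n) a =
    (\<lambda>x. \<Sum>k\<le>n. int (n choose k) * (S ^^ k) ((T ^^ (n - k)) a) x)"
proof (induction n)
  case 0
  show ?case by simp
next
  case (Suc n)
  let ?u = "\<lambda>k m. (S ^^ k) ((T ^^ m) a)"
  have "((\<lambda>a x. S a x + T a x) ^^ Suc n) a = (\<lambda>x. S (\<lambda>x. \<Sum>k\<le>n. int (n choose k) * ?u k (n - k) x) x
      + T (\<lambda>x. \<Sum>k\<le>n. int (n choose k) * ?u k (n - k) x) x)"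
    by (simp only: funpow.simps comp_def Suc.IH)
  also have "\<dots> = (\<lambda>x. (\<Sum>k\<le>n. int (n choose k) * S (?u k (n - k)) x)
      + (\<Sum>k\<le>n. int (n choose k) * T (?u k (n - k)) x))"
    by (simp only: linear_op_sum[OF S finite_atMost] linear_op_sum[OF T finite_atMost])
  also have "\<dots> = (\<lambda>x. (\<Sum>k\<le>n. int (n choose k) * ?u (Suc k) (n - k) x)
      + (\<Sum>k\<le>n. int (n choose k) * ?u k (Suc (n - k)) x))"
    using funpow_commute[of S T, OF ST] by simp
  also have "\<dots> = (\<lambda>x. \<Sum>k\<le>Suc n. int (Suc n choose k) * ?u k (Suc n - k) x)"
  proof
    fix x
    show "(\<Sum>k\<le>n. int (n choose k) * ?u (Suc k) (n - k) x) + (\<Sum>k\<le>n. int (n choose k) * ?u k (Suc (n - k)) x)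
        = (\<Sum>k\<le>Suc n. int (Suc n choose k) * ?u k (Suc n - k) x)"
      by (rule pascal_sum[where f = "\<lambda>k m. ?u k m x"])
  qed
  finally show ?case .
qed

text \<open>
  Among the binomial coefficients \<open>p choose k\<close> only those with \<open>k = 0\<close> and \<open>k = p\<close> survive modulo \<open>p\<close>.
\<close>

lemma funpow_prime_add_cong:
  assumes "linear_op S" "linear_op T" "\<And>a. S (T a) = T (S a)" and p: "Factorial_Ring.prime p"
  shows "[((\<lambda>a x. S a x + T a x) ^^ p) a x = (S ^^ p) a x + (T ^^ p) a x] (mod int p)"
proof -
  let ?t = "\<lambda>k. int (p choose k) * (S ^^ k) ((T ^^ (p - k)) a) x"
  have p1: "p > 1" by (rule prime_gt_1_nat[OF p])
  have "(\<Sum>k\<le>p. ?t k) = (\<Sum>k\<in>{..p} - {0, p}. ?t k) + (\<Sum>k\<in>{0, p}. ?t k)"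
    by (rule sum.subset_diff) auto
  also have "(\<Sum>k\<in>{0, p}. ?t k) = (S ^^ p) a x + (T ^^ p) a x"
    using p1 by simp
  finally have "(\<Sum>k\<le>p. ?t k) - ((S ^^ p) a x + (T ^^ p) a x) = (\<Sum>k\<in>{..p} - {0, p}. ?t k)"
    by linarith
  moreover have "int p dvd (\<Sum>k\<in>{..p} - {0, p}. ?t k)"
  proof (rule dvd_sum)
    fix k assume k: "k \<in> {..p} - {0, p}"
    have "p dvd (p choose k)"
      by (rule dvd_choose_prime[OF _ _ _ p]) (use k p1 in auto)
    then show "int p dvd ?t k" by (intro dvd_mult2) simp
  qed
  ultimately show ?thesis
    unfolding funpow_add_commuting[OF assms(1-3)] cong_iff_dvd_diff by (simp only:)
qed

lemma linear_op_sum_of_ops: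
  assumes "\<And>i. i \<in> I \<Longrightarrow> linear_op (T i)"
  shows "linear_op (\<lambda>a x. \<Sum>i\<in>I. T i a x)"
  unfolding linear_op_def
proof (intro conjI allI)
  fix a b
  have "(\<Sum>i\<in>I. T i (\<lambda>x. a x + b x) x) = (\<Sum>i\<in>I. T i a x + T i b x)" for x
    by (intro sum.cong refl) (simp add: linear_op_add[OF assms])
  then show "(\<lambda>x. \<Sum>i\<in>I. T i (\<lambda>x. a x + b x) x) = (\<lambda>x. (\<Sum>i\<in>I. T i a x) + (\<Sum>i\<in>I. T i b x))"
    by (simp add: sum.distrib)
next
  fix c a
  have "(\<Sum>i\<in>I. T i (\<lambda>x. c * a x) x) = (\<Sum>i\<in>I. c * T i a x)" for x
    by (intro sum.cong refl) (simp add: linear_op_scale[OF assms])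
  then show "(\<lambda>x. \<Sum>i\<in>I. T i (\<lambda>x. c * a x) x) = (\<lambda>x. c * (\<Sum>i\<in>I. T i a x))"
    by (simp add: sum_distrib_left)
qed

lemma funpow_prime_sum_cong:
  fixes T :: "'i \<Rightarrow> ('x \<Rightarrow> int) \<Rightarrow> 'x \<Rightarrow> int"
  assumes p: "Factorial_Ring.prime p" and "finite I"
    and "\<And>i. i \<in> I \<Longrightarrow> linear_op (T i)"
    and "\<And>i j a. i \<in> I \<Longrightarrow> j \<in> I \<Longrightarrow> T i (T j a) = T j (T i a)"
  shows "cong (((\<lambda>a x. \<Sum>i\<in>I. T i a x) ^^ p) a x) (\<Sum>i\<in>I. (T i ^^ p) a x) (int p)"
  using assms(2-4)
proof (induction I)
  case empty
  have "((\<lambda>a x. 0 :: int) ^^ Suc q) a x = 0" for q by simp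
  then show ?case
    using prime_gt_0_nat[OF p] gr0_conv_Suc by force
next
  case (insert j I)
  let ?U = "\<lambda>a x. \<Sum>i\<in>I. T i a x"
  have U: "linear_op ?U"
  proof (rule linear_op_sum_of_ops)
    show "linear_op (T i)" if "i \<in> I" for i
      by (rule insert.prems(1)) (rule insertI2[OF that])
  qed
  have j: "linear_op (T j)" by (rule insert.prems(1)) (rule insertI1)
  have comm: "T j (?U a) = ?U (T j a)" for a
  proof -
    have "T j (?U a) = (\<lambda>x. \<Sum>i\<in>I. T j (T i a) x)"
      using linear_op_sum[OF j insert.hyps(1), of "\<lambda>_. 1" "\<lambda>i. T i a"] by (simp only: mult_1)
    also have "\<dots> = ?U (T j a)"
    proof (intro ext sum.cong refl)
      fix x i assume "i \<in> I"
      then have "T j (T i a) = T i (T j a)"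
        by (intro insert.prems(2) insertI1 insertI2)
      then show "T j (T i a) x = T i (T j a) x" by (rule fun_cong)
    qed
    finally show ?thesis .
  qed
  have "(\<lambda>a x. \<Sum>i\<in>insert j I. T i a x) = (\<lambda>a x. T j a x + ?U a x)"
    using insert.hyps by simp
  then have "((\<lambda>a x. \<Sum>i\<in>insert j I. T i a x) ^^ p) a x = ((\<lambda>a x. T j a x + ?U a x) ^^ p) a x"
    by (rule arg_cong)
  also have "[((\<lambda>a x. T j a x + ?U a x) ^^ p) a x = (T j ^^ p) a x + (?U ^^ p) a x] (mod int p)"
    by (rule funpow_prime_add_cong[OF j U comm p])
  also have "[(T j ^^ p) a x + (?U ^^ p) a x = (T j ^^ p) a x + (\<Sum>i\<in>I. (T i ^^ p) a x)] (mod int p)"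
  proof (rule cong_add[OF cong_refl])
    show "[(?U ^^ p) a x = (\<Sum>i\<in>I. (T i ^^ p) a x)] (mod int p)"
    proof (rule insert.IH)
      show "linear_op (T i)" if "i \<in> I" for i
        by (rule insert.prems(1)) (rule insertI2[OF that])
      show "T i (T k a) = T k (T i a)" if "i \<in> I" "k \<in> I" for i k a
        by (rule insert.prems(2)) (rule insertI2[OF that(1)], rule insertI2[OF that(2)])
    qed
  qed
  also have "(T j ^^ p) a x + (\<Sum>i\<in>I. (T i ^^ p) a x) = (\<Sum>i\<in>insert j I. (T i ^^ p) a x)"
    using insert.hyps by simp
  finally show ?case .
qed

section \<open>Dilating a tile by a prime power\<close>

context comm_group begin

text \<open>
  Cutting off outside the carrier makes translations by group elements commute as total functions, so
  that the Frobenius congruence applies to them directly.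
\<close>

definition shift_op :: "'a \<Rightarrow> ('a \<Rightarrow> int) \<Rightarrow> 'a \<Rightarrow> int"
  where "shift_op v a = (\<lambda>x. if x \<in> carrier G then a (inv v \<otimes> x) else 0)"

lemma linear_op_shift_op: "linear_op (shift_op v)"
  by (auto simp: linear_op_def shift_op_def)

lemma shift_op_apply: "x \<in> carrier G \<Longrightarrow> shift_op v a x = a (inv v \<otimes> x)"
  by (simp add: shift_op_def)

lemma shift_op_commute:
  assumes "v \<in> carrier G" "w \<in> carrier G"
  shows "shift_op v (shift_op w a) = shift_op w (shift_op v a)"
  using assms by (auto simp: shift_op_def fun_eq_iff m_lcomm)

lemma funpow_shift_op:
  assumes "v \<in> carrier G"
  shows "x \<in> carrier G \<Longrightarrow> (shift_op v ^^ n) a x = a (inv (v [^] n) \<otimes> x)"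
proof (induction n arbitrary: x)
  case (Suc n)
  have "inv (v [^] Suc n) \<otimes> x = inv (v [^] n) \<otimes> (inv v \<otimes> x)"
    using assms Suc.prems by (simp add: inv_mult m_assoc)
  moreover have "(shift_op v ^^ Suc n) a x = a (inv (v [^] n) \<otimes> (inv v \<otimes> x))"
    using assms Suc.prems by (simp add: shift_op_apply Suc.IH)
  ultimately show ?case by (simp only:)
qed simp

text \<open>
  Write \<open>T\<close> for convolution with the tile, so that \<open>T a = 1\<close>. Iterating, \<open>T\<^sup>p a\<close> is the constant
  \<open>(card I)\<^sup>p\<^sup>-\<^sup>1\<close>, which is \<open>1\<close> modulo \<open>p\<close> by Fermat's little theorem. By the Frobenius congruence it is also,
  modulo \<open>p\<close>, the number of \<open>i\<close> for which \<open>a\<close> takes the value \<open>1\<close> at \<open>x - p v\<^sub>i\<close>. That number is at most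
  \<open>card I < p\<close>, so the congruence is an equality: the dilated tile still tiles, with the same
  complement. A family \<open>v\<close> is used in place of a set so that the statement can be iterated without
  asking whether dilation is injective.
\<close>

lemma dilate_prime:
  assumes I: "finite I" and p: "Factorial_Ring.prime p" "card I < p"
    and v: "\<And>i. i \<in> I \<Longrightarrow> v i \<in> carrier G"
    and a: "\<And>x. x \<in> carrier G \<Longrightarrow> a x \<in> {0, 1 :: int}"
    and sum: "\<And>x. x \<in> carrier G \<Longrightarrow> (\<Sum>i\<in>I. a (inv (v i) \<otimes> x)) = 1"
    and x: "x \<in> carrier G"
  shows "(\<Sum>i\<in>I. a (inv (v i [^] p) \<otimes> x)) = 1"
proof -
  let ?T = "\<lambda>a x. \<Sum>i\<in>I. shift_op (v i) a x"
  \<comment> \<open>The function that is constantly one, in the cut-off form produced by \<open>shift_op\<close>.\<close>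
  define u where "u = (\<lambda>x. if x \<in> carrier G then 1 else 0 :: int)"
  have Ta: "?T a = u"
  proof
    fix y
    show "?T a y = u y"
      using sum[of y] by (cases "y \<in> carrier G") (simp_all add: u_def shift_op_def)
  qed
  have Tu: "?T (\<lambda>x. c * u x) = (\<lambda>x. int (card I) * c * u x)" for c
  proof
    fix y
    have "shift_op (v i) (\<lambda>x. c * u x) y = c * u y" if "i \<in> I" for i
      using v[OF that] by (simp add: u_def shift_op_def)
    then have "?T (\<lambda>x. c * u x) y = (\<Sum>i\<in>I. c * u y)"
      by (intro sum.cong refl)
    then show "?T (\<lambda>x. c * u x) y = int (card I) * c * u y" by simp
  qed
  have Tn: "(?T ^^ Suc n) a = (\<lambda>x. int (card I) ^ n * u x)" for n
  proof (induction n)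
    case 0
    show ?case using Ta by simp
  next
    case (Suc n)
    have "(?T ^^ Suc (Suc n)) a = ?T ((?T ^^ Suc n) a)" by simp
    also have "\<dots> = (\<lambda>x. int (card I) ^ Suc n * u x)"
      by (simp only: Suc Tu power_Suc)
    finally show ?case .
  qed
  let ?s = "\<Sum>i\<in>I. a (inv (v i [^] p) \<otimes> x)"
  have "card I \<noteq> 0"
    using sum[OF x] I by auto
  then have "[card I ^ (p - 1) = 1] (mod p)"
    using p(2) by (intro fermat_theorem[OF p(1)]) (simp add: nat_dvd_not_less)
  then have "[int (card I) ^ (p - 1) = 1] (mod int p)"
    using cong_int_iff[of "card I ^ (p - 1)" 1 p] by simp
  moreover have "(?T ^^ p) a x = int (card I) ^ (p - 1)"
    using fun_cong[OF Tn[of "p - 1"], of x] x prime_gt_0_nat[OF p(1)]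
    by (simp add: u_def del: funpow.simps)
  moreover have "[(?T ^^ p) a x = (\<Sum>i\<in>I. (shift_op (v i) ^^ p) a x)] (mod int p)"
    by (rule funpow_prime_sum_cong[OF p(1) I linear_op_shift_op shift_op_commute[OF v v]])
  moreover have "(\<Sum>i\<in>I. (shift_op (v i) ^^ p) a x) = ?s"
    by (intro sum.cong refl funpow_shift_op v x)
  ultimately have cong: "[?s = 1] (mod int p)"
    unfolding cong_def by (simp only:)
  have a01: "0 \<le> a (inv (v i [^] p) \<otimes> x) \<and> a (inv (v i [^] p) \<otimes> x) \<le> 1" if "i \<in> I" for i
  proof -
    have "inv (v i [^] p) \<otimes> x \<in> carrier G" using v[OF that] x by simp
    from a[OF this] show ?thesis by (elim insertE) simp_all
  qed
  have "0 \<le> ?s" by (intro sum_nonneg conjunct1[OF a01])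
  moreover have "?s \<le> (\<Sum>i\<in>I. 1)" by (intro sum_mono conjunct2[OF a01])
  then have "?s < int p" using p(2) by simp
  ultimately show ?thesis
    using prime_gt_1_nat[OF p(1)] by (intro cong_less_imp_eq_int[OF _ _ _ _ cong]) simp_all
qed

lemma dilate_prime_power:
  assumes I: "finite I" and p: "Factorial_Ring.prime p" "card I < p"
    and v: "\<And>i. i \<in> I \<Longrightarrow> v i \<in> carrier G"
    and a: "\<And>x. x \<in> carrier G \<Longrightarrow> a x \<in> {0, 1 :: int}"
    and sum: "\<And>x. x \<in> carrier G \<Longrightarrow> (\<Sum>i\<in>I. a (inv (v i) \<otimes> x)) = 1"
    and "x \<in> carrier G"
  shows "(\<Sum>i\<in>I. a (inv (v i [^] (p ^ k)) \<otimes> x)) = 1"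
  using \<open>x \<in> carrier G\<close>
proof (induction k arbitrary: x)
  case 0
  then show ?case using v sum by simp
next
  case (Suc k)
  have "v i [^] (p ^ Suc k) = (v i [^] (p ^ k)) [^] p" if "i \<in> I" for i
    using v[OF that] by (simp add: nat_pow_pow mult.commute)
  then have "(\<Sum>i\<in>I. a (inv (v i [^] (p ^ Suc k)) \<otimes> x)) = (\<Sum>i\<in>I. a (inv ((v i [^] (p ^ k)) [^] p) \<otimes> x))"
    by (intro sum.cong refl) (simp only:)
  also have "\<dots> = 1"
    by (rule dilate_prime[OF I p _ a Suc.IH Suc.prems]) (use v in auto)
  finally show ?case .
qed

lemma mem_l_coset_iff:
  assumes "A \<subseteq> carrier G" "f \<in> carrier G" "x \<in> carrier G"
  shows "x \<in> f <# A \<longleftrightarrow> inv f \<otimes> x \<in> A"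
proof
  assume "x \<in> f <# A"
  then obtain h where "h \<in> A" "x = f \<otimes> h" by (auto simp: l_coset_def)
  moreover from this have "h \<in> carrier G" using assms by blast
  ultimately show "inv f \<otimes> x \<in> A" using assms(2) by (simp add: m_assoc[symmetric])
next
  assume "inv f \<otimes> x \<in> A"
  moreover have "x = f \<otimes> (inv f \<otimes> x)" using assms by (simp add: m_assoc[symmetric])
  ultimately show "x \<in> f <# A" unfolding l_coset_def by blast
qed

text \<open>
  The convolution form of a tiling, \<open>1\<^sub>F * 1\<^sub>A = 1\<close>.
\<close>

lemma tiling_iff_sum:
  assumes F: "F \<subseteq> carrier G" "finite F" and A: "A \<subseteq> carrier G"
  shows "tiling G F A \<longleftrightarrow> (\<forall>x\<in>carrier G. (\<Sum>f\<in>F. indicator A (inv f \<otimes> x)) = (1 :: int))"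
proof -
  have sum: "(\<Sum>f\<in>F. indicator A (inv f \<otimes> x)) = int (card {f\<in>F. inv f \<otimes> x \<in> A})" for x
    using F(2) by (simp add: indicator_def sum.If_cases Int_def)
  have sub: "f <# A \<subseteq> carrier G" if "f \<in> F" for f
    using that F A by (intro l_coset_subset_G) auto
  have mem: "x \<in> f <# A \<longleftrightarrow> inv f \<otimes> x \<in> A" if "f \<in> F" "x \<in> carrier G" for f x
    using that F by (intro mem_l_coset_iff A) auto
  have "tiling G F A \<longleftrightarrow> (\<forall>x\<in>carrier G. card {f\<in>F. x \<in> f <# A} = 1)"
  proof (intro iffI ballI)
    fix x assume "tiling G F A" and x: "x \<in> carrier G"
    then have disj: "disjoint_family_on (\<lambda>f. f <# A) F" and "x \<in> (\<Union>f\<in>F. f <# A)"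
      by (simp_all add: tiling_def)
    then obtain f where f: "f \<in> F" "x \<in> f <# A" by blast
    have "h = f" if "h \<in> F" "x \<in> h <# A" for h
      using disjoint_family_onD[OF disj that(1) f(1)] that(2) f(2) by blast
    then have "{f\<in>F. x \<in> f <# A} = {f}" using f by blast
    then show "card {f\<in>F. x \<in> f <# A} = 1" by simp
  next
    assume *: "\<forall>x\<in>carrier G. card {f\<in>F. x \<in> f <# A} = 1"
    have "disjoint_family_on (\<lambda>f. f <# A) F"
      unfolding disjoint_family_on_def
    proof (intro ballI impI equals0I)
      fix f h x assume fh: "f \<in> F" "h \<in> F" "f \<noteq> h" and x: "x \<in> (f <# A) \<inter> (h <# A)"
      then have "x \<in> carrier G" using sub[of f] by blast
      then obtain k where k: "{f\<in>F. x \<in> f <# A} = {k}" using * by (meson card_1_singletonE)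
      have "f \<in> {f\<in>F. x \<in> f <# A}" "h \<in> {f\<in>F. x \<in> f <# A}" using fh x by auto
      then show False using fh(3) unfolding k by simp
    qed
    moreover have "carrier G \<subseteq> (\<Union>f\<in>F. f <# A)"
    proof
      fix x assume "x \<in> carrier G"
      then obtain k where "{f\<in>F. x \<in> f <# A} = {k}" using * by (meson card_1_singletonE)
      then show "x \<in> (\<Union>f\<in>F. f <# A)" by blast
    qed
    ultimately show "tiling G F A"
      unfolding tiling_def using F(1) A UN_least[of F "\<lambda>f. f <# A", OF sub] by (intro conjI subset_antisym)
  qed
  also have "\<dots> \<longleftrightarrow> (\<forall>x\<in>carrier G. card {f\<in>F. inv f \<otimes> x \<in> A} = 1)"
  proof (intro ball_cong refl)
    fix x assume "x \<in> carrier G"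
    then have "{f\<in>F. x \<in> f <# A} = {f\<in>F. inv f \<otimes> x \<in> A}" using mem by blast
    then show "card {f\<in>F. x \<in> f <# A} = 1 \<longleftrightarrow> card {f\<in>F. inv f \<otimes> x \<in> A} = 1" by simp
  qed
  finally show ?thesis by (simp add: sum)
qed

end

section \<open>Mixing of iid processes\<close>

text \<open>
  The sets that can be approximated in measure by members of the algebra form a \<open>\<sigma>\<close>-algebra. For a
  countable union, finitely many of the sets already exhaust all but \<open>e / 2\<close> of the measure, and the
  remaining \<open>e / 2\<close> is shared among their approximations.
\<close>

lemma (in finite_measure) approximate_by_algebra:
  assumes alg: "Sigma_Algebra.algebra (space M) \<G>" and gen: "sets M = sigma_sets (space M) \<G>"
    and E: "E \<in> sets M" and e: "0 < e"
  shows "\<exists>C\<in>\<G>. measure M (sym_diff E C) < e"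
proof -
  interpret \<G>: Sigma_Algebra.algebra "space M" \<G> by (rule alg)
  have \<G>: "C \<in> sets M" if "C \<in> \<G>" for C
    using that gen by (simp add: sigma_sets.Basic)
  have "E \<in> sigma_sets (space M) \<G>" using E gen by simp
  then show ?thesis using e
  proof (induction arbitrary: e rule: sigma_sets.induct)
    case (Basic C)
    then show ?case by (intro bexI[of _ C]) auto
  next
    case Empty
    then show ?case by (intro bexI[of _ "{}"]) auto
  next
    case (Compl A)
    then obtain C where C: "C \<in> \<G>" "measure M (sym_diff A C) < e" by blast
    moreover have "sym_diff (space M - A) (space M - C) = sym_diff A C"
    proof -
      have "A \<subseteq> space M" "C \<subseteq> space M"
        using Compl.hyps \<G>[OF C(1)] by (simp_all add: gen[symmetric] sets.sets_into_space)
      then show ?thesis by blast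
    qed
    ultimately show ?case by (intro bexI[of _ "space M - C"]) auto
  next
    case (Union A)
    have A: "A i \<in> sets M" for i using Union.hyps gen by simp
    have "(\<lambda>n. measure M (\<Union>i. A i) - measure M (\<Union>i<n. A i)) \<longlonglongrightarrow> measure M (\<Union>i. A i) - measure M (\<Union>n. \<Union>i<n. A i)"
      using A by (intro tendsto_intros finite_Lim_measure_incseq) (fastforce simp: incseq_def)+
    moreover have "(\<Union>n. \<Union>i<n. A i) = (\<Union>i. A i)" by blast
    ultimately have "(\<lambda>n. measure M (\<Union>i. A i) - measure M (\<Union>i<n. A i)) \<longlonglongrightarrow> 0"
      by simp
    then have "\<forall>\<^sub>F n in sequentially. measure M (\<Union>i. A i) - measure M (\<Union>i<n. A i) < e / 2"
      using Union.prems by (intro order_tendstoD(2)[of _ 0]) auto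
    then obtain n where n: "measure M (\<Union>i. A i) - measure M (\<Union>i<n. A i) < e / 2"
      by (auto simp: eventually_sequentially)
    have "\<exists>C\<in>\<G>. measure M (sym_diff (A i) C) < e / (2 * real (Suc n))" for i
      using Union.prems by (intro Union.IH) simp
    then obtain C where C: "\<And>i. C i \<in> \<G>" "\<And>i. measure M (sym_diff (A i) (C i)) < e / (2 * real (Suc n))"
      by metis
    have mC: "C i \<in> sets M" for i using C(1) by (rule \<G>)
    let ?D = "\<Union>i<n. C i"
    have D: "?D \<in> \<G>" using C(1) by (intro \<G>.finite_UN) auto
    have "measure M (sym_diff (\<Union>i. A i) ?D)
        \<le> measure M (((\<Union>i. A i) - (\<Union>i<n. A i)) \<union> (\<Union>i<n. sym_diff (A i) (C i)))"
      using A mC by (intro finite_measure_mono) auto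
    also have "\<dots> \<le> measure M ((\<Union>i. A i) - (\<Union>i<n. A i)) + measure M (\<Union>i<n. sym_diff (A i) (C i))"
      using A mC by (intro measure_Un_le) auto
    also have "measure M ((\<Union>i. A i) - (\<Union>i<n. A i)) = measure M (\<Union>i. A i) - measure M (\<Union>i<n. A i)"
      using A by (intro finite_measure_Diff) auto
    also have "measure M (\<Union>i<n. sym_diff (A i) (C i)) \<le> (\<Sum>i<n. measure M (sym_diff (A i) (C i)))"
      using A mC by (intro finite_measure_subadditive_finite) auto
    also have "\<dots> \<le> (\<Sum>i<n. e / (2 * real (Suc n)))"
      using C(2) by (intro sum_mono less_imp_le)
    also have "\<dots> = e / 2 * (real n / real (Suc n))" by simp
    also have "\<dots> \<le> e / 2 * 1"
      using Union.prems by (intro mult_left_mono) auto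
    finally have "measure M (sym_diff (\<Union>i. A i) ?D) < e" using n by linarith
    then show ?case using D by blast
  qed
qed

text \<open>@\<close>
text \<open>
  Stationarity: relabelling the coordinates of an infinite product of equal factors along an injection
  leaves the product measure unchanged.
\<close>

lemma distr_shift_iid:
  assumes "prob_space M" "group G" "prob_space U"
    and indep: "prob_space.indep_vars M (\<lambda>_. U) Z (carrier G)"
    and Z: "\<And>x. x \<in> carrier G \<Longrightarrow> distr M U (Z x) = U"
    and g: "g \<in> carrier G"
  shows "distr M (\<Pi>\<^sub>M x\<in>carrier G. U) (\<lambda>w. \<lambda>x\<in>carrier G. Z (g \<otimes>\<^bsub>G\<^esub> x) w) = (\<Pi>\<^sub>M x\<in>carrier G. U)"
proof -
  interpret prob_space M by fact
  interpret group G by fact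
  let ?P = "\<Pi>\<^sub>M x\<in>carrier G. U"
  let ?L = "\<lambda>w. \<lambda>x\<in>carrier G. Z x w" and ?S = "\<lambda>y. \<lambda>x\<in>carrier G. y (g \<otimes>\<^bsub>G\<^esub> x)"
  have rv: "random_variable U (Z x)" if "x \<in> carrier G" for x
    using indep that by (simp add: indep_vars_def)
  have "distr M ?P ?L = (\<Pi>\<^sub>M x\<in>carrier G. distr M U (Z x))"
    by (rule iffD1[OF indep_vars_iff_distr_eq_PiM' indep]) (use rv in auto)
  also have "\<dots> = ?P" by (intro PiM_cong refl Z)
  finally have L: "distr M ?P ?L = ?P" .
  have mL: "?L \<in> measurable M ?P" by (intro measurable_restrict rv)
  have mS: "?S \<in> measurable ?P ?P"
    using g by (intro measurable_restrict measurable_component_singleton) auto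
  have "distr ?P ?P ?S = ?P"
    by (rule distr_PiM_reindex) (use g assms(3) in \<open>auto simp: inj_on_def\<close>)
  then have "distr (distr M ?P ?L) ?P ?S = ?P" by (simp only: L)
  then have "distr M ?P (?S \<circ> ?L) = ?P" using distr_distr[OF mS mL] by simp
  moreover have "?S (?L w) = (\<lambda>x\<in>carrier G. Z (g \<otimes>\<^bsub>G\<^esub> x) w)" for w
    using g by (intro restrict_ext) simp
  ultimately show ?thesis by (simp add: comp_def)
qed

text \<open>
  A cylinder event depends only on coordinates in a finite set \<open>J\<close>, so its shifts by \<open>g\<close> and \<open>h\<close> are
  exactly independent as soon as \<open>g + J\<close> and \<open>h + J\<close> are disjoint. An arbitrary event \<open>E\<close> differs from
  some cylinder event \<open>C\<close> by less than \<open>e / 4\<close> in measure. Replacing \<open>E\<close> by \<open>C\<close> costs this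
  error twice in the joint probability, once for each shift, and twice in the square of the
  probability.
\<close>

lemma iid_mixing:
  assumes "prob_space M" "group G" "prob_space U"
    and indep: "prob_space.indep_vars M (\<lambda>_. U) Z (carrier G)"
    and Z: "\<And>x. x \<in> carrier G \<Longrightarrow> distr M U (Z x) = U"
    and E: "E \<in> sets (\<Pi>\<^sub>M x\<in>carrier G. U)" and e: "0 < e"
  shows "\<exists>J\<subseteq>carrier G. finite J \<and> (\<forall>g\<in>carrier G. \<forall>h\<in>carrier G.
    (g <#\<^bsub>G\<^esub> J) \<inter> (h <#\<^bsub>G\<^esub> J) = {} \<longrightarrow>
    \<bar>measure M {w \<in> space M. (\<lambda>x\<in>carrier G. Z (g \<otimes>\<^bsub>G\<^esub> x) w) \<in> E \<and> (\<lambda>x\<in>carrier G. Z (h \<otimes>\<^bsub>G\<^esub> x) w) \<in> E}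
      - (measure (\<Pi>\<^sub>M x\<in>carrier G. U) E)\<^sup>2\<bar> < e)"
proof -
  interpret prob_space M by fact
  interpret group G by fact
  interpret U: prob_space U by fact
  interpret P: product_prob_space "\<lambda>_. U" "carrier G" ..
  let ?P = "\<Pi>\<^sub>M x\<in>carrier G. U"
  define L where "L g w = (\<lambda>x\<in>carrier G. Z (g \<otimes>\<^bsub>G\<^esub> x) w)" for g w
  define q where "q = measure ?P E"
  have rv: "random_variable U (Z x)" if "x \<in> carrier G" for x
    using indep that by (simp add: indep_vars_def)
  have mL: "L g \<in> measurable M ?P" if "g \<in> carrier G" for g
    unfolding L_def using that by (intro measurable_restrict rv) auto
  have law: "prob (L g -` B \<inter> space M) = measure ?P B" if "g \<in> carrier G" "B \<in> sets ?P" for g B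
    using measure_distr[OF mL[OF that(1)] that(2)]
      distr_shift_iid[OF assms(1-3) indep Z that(1), folded L_def] by simp
  obtain C where C: "C \<in> P.generator" "measure ?P (sym_diff E C) < e / 4"
    using P.approximate_by_algebra[OF P.algebra_generator P.sets_PiM_generator E, of "e / 4"] e by auto
  from C(1) obtain J B where J: "finite J" "J \<subseteq> carrier G" "B \<in> sets (PiM J (\<lambda>_. U))"
    and CB: "C = prod_emb (carrier G) (\<lambda>_. U) J B"
    by (auto elim!: P.generator.cases)
  have mC: "C \<in> sets ?P" unfolding CB using J by (intro measurable_prod_emb) auto
  define r where "r = measure ?P C"
  have mD: "sym_diff E C \<in> sets ?P" using E mC by auto
  have qr: "\<bar>q - r\<bar> < e / 4"
  proof -
    have "q \<le> measure ?P (C \<union> sym_diff E C)" "r \<le> measure ?P (E \<union> sym_diff E C)"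
      unfolding q_def r_def using E mC by (auto intro!: P.finite_measure_mono)
    moreover have "measure ?P (C \<union> sym_diff E C) \<le> r + measure ?P (sym_diff E C)"
      "measure ?P (E \<union> sym_diff E C) \<le> q + measure ?P (sym_diff E C)"
      unfolding q_def r_def using E mC mD by (auto intro!: measure_Un_le)
    ultimately show ?thesis using C(2) by linarith
  qed
  have "\<bar>prob {w \<in> space M. L g w \<in> E \<and> L h w \<in> E} - q\<^sup>2\<bar> < e"
    if g: "g \<in> carrier G" and h: "h \<in> carrier G" and disj: "(g <#\<^bsub>G\<^esub> J) \<inter> (h <#\<^bsub>G\<^esub> J) = {}" for g h
  proof -
    let ?both = "\<lambda>B. (L g -` B \<inter> space M) \<inter> (L h -` B \<inter> space M)"
    \<comment> \<open>Outside this event, replacing \<open>E\<close> by \<open>C\<close> changes neither of the two shifted events.\<close>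
    let ?bad = "(L g -` sym_diff E C \<inter> space M) \<union> (L h -` sym_diff E C \<inter> space M)"
    have ev: "L k -` B \<inter> space M \<in> events" if "k \<in> {g, h}" "B \<in> sets ?P" for k B
      using that g h by (auto intro: measurable_sets[OF mL])
    have bad: "prob ?bad < e / 2"
    proof -
      have "prob ?bad \<le> measure ?P (sym_diff E C) + measure ?P (sym_diff E C)"
        using measure_Un_le[OF ev[of g, OF _ mD] ev[of h, OF _ mD]] law[OF g mD] law[OF h mD] by simp
      then show ?thesis using C(2) by linarith
    qed
    have evbad: "?bad \<in> events" using ev[OF _ mD] by blast
    have evE: "?both E \<in> events" and evC: "?both C \<in> events"
      using ev[OF _ E] ev[OF _ mC] by blast+
    have 1: "\<bar>prob (?both E) - prob (?both C)\<bar> < e / 2"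
    proof -
      have "prob (?both E) \<le> prob (?both C \<union> ?bad)" "prob (?both C) \<le> prob (?both E \<union> ?bad)"
        using evE evC evbad by (auto intro!: finite_measure_mono)
      moreover have "prob (?both C \<union> ?bad) \<le> prob (?both C) + prob ?bad"
        "prob (?both E \<union> ?bad) \<le> prob (?both E) + prob ?bad"
        using evE evC evbad by (auto intro!: measure_Un_le)
      ultimately show ?thesis using bad by linarith
    qed
    have 2: "prob (?both C) = r\<^sup>2"
    proof -
      let ?I = "\<lambda>k. k <#\<^bsub>G\<^esub> J"
      let ?Y = "\<lambda>k w. \<lambda>i\<in>?I k. Z i w"
      let ?T = "\<lambda>k y. \<lambda>j\<in>J. y (k \<otimes>\<^bsub>G\<^esub> j)"
      have sub: "?I k \<subseteq> carrier G" if "k \<in> carrier G" for k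
        using that J(2) by (rule l_coset_subset_G[rotated])
      have mT: "?T k \<in> measurable (PiM (?I k) (\<lambda>_. U)) (PiM J (\<lambda>_. U))" for k
        by (intro measurable_restrict measurable_component_singleton) (auto simp: l_coset_def)
      have TY: "L k -` C \<inter> space M = (\<lambda>w. ?T k (?Y k w)) -` B \<inter> space M" if "k \<in> carrier G" for k
      proof -
        have "?T k (?Y k w) = restrict (L k w) J" for w
          unfolding L_def using J(2) by (intro ext) (auto simp: l_coset_def)
        moreover have "L k w \<in> extensional (carrier G)" for w
          by (simp add: L_def)
        moreover have "L k w x \<in> space U" if "w \<in> space M" "x \<in> carrier G" for w x
          using measurable_space[OF rv, of "k \<otimes>\<^bsub>G\<^esub> x" w] that \<open>k \<in> carrier G\<close> by (simp add: L_def)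
        ultimately show ?thesis unfolding CB by (auto simp: prod_emb_iff)
      qed
      have "indep_var (PiM (?I g) (\<lambda>_. U)) (?Y g) (PiM (?I h) (\<lambda>_. U)) (?Y h)"
        by (intro indep_var_restrict[OF indep disj] sub g h)
      then have "indep_var (PiM J (\<lambda>_. U)) (?T g \<circ> ?Y g) (PiM J (\<lambda>_. U)) (?T h \<circ> ?Y h)"
        by (rule indep_var_compose[OF _ mT mT])
      from indep_varD[OF this J(3) J(3)]
      have "prob (?both C) = prob (L g -` C \<inter> space M) * prob (L h -` C \<inter> space M)"
        unfolding TY[OF g] TY[OF h] by (simp add: comp_def vimage_def Int_def conj_ac)
      then show ?thesis
        unfolding law[OF g mC] law[OF h mC] r_def by (simp add: power2_eq_square)
    qed
    have "\<bar>r\<^sup>2 - q\<^sup>2\<bar> = \<bar>q - r\<bar> * \<bar>r + q\<bar>"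
      by (simp add: abs_mult[symmetric] power2_eq_square algebra_simps)
    also have "\<dots> \<le> \<bar>q - r\<bar> * 2"
      using P.prob_le_1[of E] P.prob_le_1[of C] measure_nonneg[of ?P E] measure_nonneg[of ?P C]
      unfolding q_def[symmetric] r_def[symmetric] by (intro mult_left_mono) linarith+
    also have "\<dots> < e / 4 * 2" using qr by (rule mult_strict_right_mono) simp
    finally have "\<bar>r\<^sup>2 - q\<^sup>2\<bar> < e / 2" by simp
    moreover have "{w \<in> space M. L g w \<in> E \<and> L h w \<in> E} = ?both E" by auto
    ultimately show ?thesis using 1 unfolding 2 abs_less_iff by (simp only:) linarith
  qed
  then show ?thesis
    using J(1,2) unfolding L_def q_def by blast
qed

section \<open>The group and its fibres\<close>

lemma comm_group_DirProd:
  assumes "comm_group K" "comm_group H"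
  shows "comm_group (K \<times>\<times> H)"
proof -
  interpret K: comm_group K by fact
  interpret H: comm_group H by fact
  have "group (K \<times>\<times> H)" by (intro DirProd_group K.is_group H.is_group)
  then show ?thesis
    by (rule group.group_comm_groupI) (auto simp: K.m_comm H.m_comm)
qed

lemma comm_group_lattice_group: "comm_group (lattice_group d)"
proof -
  have "group (lattice_group d)"
    unfolding lattice_group_def by (rule product_group) (rule group_integer_group)
  then show ?thesis
    by (rule group.group_comm_groupI) (auto simp: lattice_group_def add.commute intro!: restrict_ext)
qed

lemma countable_lattice_group: "countable (carrier (lattice_group d))"
  unfolding lattice_group_def by (auto intro!: countable_PiE)

lemma lattice_group_pow:
  assumes "i < d" "v \<in> carrier (lattice_group d)"
  shows "(v [^]\<^bsub>lattice_group d\<^esub> (n :: nat)) i = int n * v i"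
proof -
  interpret comm_group "lattice_group d" by (rule comm_group_lattice_group)
  show ?thesis
  proof (induction n)
    case 0
    then show ?case using assms by (simp add: lattice_group_def)
  next
    case (Suc n)
    have "(v [^]\<^bsub>lattice_group d\<^esub> Suc n) i = (v [^]\<^bsub>lattice_group d\<^esub> n) i + v i"
      using assms(1) by (simp add: lattice_group_def)
    then show ?case using Suc by (simp add: algebra_simps)
  qed
qed

lemma DirProd_pow: "(x [^]\<^bsub>K \<times>\<times> H\<^esub> (n :: nat)) = (fst x [^]\<^bsub>K\<^esub> n, snd x [^]\<^bsub>H\<^esub> n)"
  by (induction n) (auto simp: mult_DirProd')

lemma lattice_group_torsion_free:
  assumes v: "v \<in> carrier (lattice_group d)" and w: "w \<in> carrier (lattice_group d)"
    and n: "0 < n" "v [^]\<^bsub>lattice_group d\<^esub> n = w [^]\<^bsub>lattice_group d\<^esub> (n :: nat)"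
  shows "v = w"
proof (rule PiE_ext)
  show "v \<in> {..<d} \<rightarrow>\<^sub>E UNIV" "w \<in> {..<d} \<rightarrow>\<^sub>E UNIV"
    using v w by (simp_all add: lattice_group_def)
  fix i assume "i \<in> {..<d}"
  then have i: "i < d" by simp
  have "int n * v i = int n * w i"
    by (simp only: lattice_group_pow[OF i v, symmetric] lattice_group_pow[OF i w, symmetric] n(2))
  then show "v i = w i" using n(1) by simp
qed

lemma (in comm_group) tiling_translate:
  assumes "tiling G F A" "finite F" "h \<in> carrier G"
  shows "tiling G F {g \<in> carrier G. inv h \<otimes> g \<in> A}"
proof -
  have F: "F \<subseteq> carrier G" and A: "A \<subseteq> carrier G" using assms(1) by (auto simp: tiling_def)
  have sum: "(\<Sum>f\<in>F. indicator A (inv f \<otimes> x)) = (1 :: int)" if "x \<in> carrier G" for x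
    using tiling_iff_sum[OF F assms(2) A] assms(1) that by blast
  have "(\<Sum>f\<in>F. indicator {g \<in> carrier G. inv h \<otimes> g \<in> A} (inv f \<otimes> x)) = (1 :: int)"
    if x: "x \<in> carrier G" for x
  proof -
    have "(\<Sum>f\<in>F. indicator {g \<in> carrier G. inv h \<otimes> g \<in> A} (inv f \<otimes> x))
        = (\<Sum>f\<in>F. indicator A (inv f \<otimes> (inv h \<otimes> x)) :: int)"
    proof (intro sum.cong refl)
      fix f assume "f \<in> F"
      then have f: "f \<in> carrier G" using F by blast
      then have "inv h \<otimes> (inv f \<otimes> x) = inv f \<otimes> (inv h \<otimes> x)"
        using assms(3) x by (simp add: m_lcomm)
      then show "indicator {g \<in> carrier G. inv h \<otimes> g \<in> A} (inv f \<otimes> x)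
          = (indicator A (inv f \<otimes> (inv h \<otimes> x)) :: int)"
        using f x by (simp add: indicator_def)
    qed
    also have "\<dots> = 1" using sum assms(3) x by simp
    finally show ?thesis .
  qed
  then show ?thesis by (subst tiling_iff_sum[OF F assms(2)]) auto
qed

text \<open>
  Translation by an element of \<open>{u} \<times> F\<close> sends the fibre over \<open>v\<close> into the fibre over \<open>u + v\<close>, so
  the fibres are tiled independently of each other.
\<close>

lemma tiling_single_fibre_iff:
  assumes "comm_group K" "comm_group H" and u: "u \<in> carrier K"
    and F: "F \<subseteq> carrier H" "finite F" and A: "A \<subseteq> carrier (K \<times>\<times> H)"
  shows "tiling (K \<times>\<times> H) ({u} \<times> F) A \<longleftrightarrow>
    (\<forall>v\<in>carrier K. tiling H F {g \<in> carrier H. (v, g) \<in> A})"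
proof -
  interpret K: comm_group K by fact
  interpret H: comm_group H by fact
  interpret KH: comm_group "K \<times>\<times> H" by (intro comm_group_DirProd assms)
  let ?S = "\<lambda>v. {g \<in> carrier H. (v, g) \<in> A}"
  have fibre_sum: "(\<Sum>f\<in>{u} \<times> F. indicator A (inv\<^bsub>K \<times>\<times> H\<^esub> f \<otimes>\<^bsub>K \<times>\<times> H\<^esub> (w, g)) :: int)
      = (\<Sum>f\<in>F. indicator (?S (inv\<^bsub>K\<^esub> u \<otimes>\<^bsub>K\<^esub> w)) (inv\<^bsub>H\<^esub> f \<otimes>\<^bsub>H\<^esub> g))"
    if g: "g \<in> carrier H" for w g
  proof -
    have "(\<Sum>f\<in>{u} \<times> F. indicator A (inv\<^bsub>K \<times>\<times> H\<^esub> f \<otimes>\<^bsub>K \<times>\<times> H\<^esub> (w, g)) :: int)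
      = (\<Sum>f\<in>F. indicator A (inv\<^bsub>K \<times>\<times> H\<^esub> (u, f) \<otimes>\<^bsub>K \<times>\<times> H\<^esub> (w, g)))"
      by (rule sum.reindex_bij_witness[of _ "Pair u" snd]) auto
    also have "\<dots> = (\<Sum>f\<in>F. indicator (?S (inv\<^bsub>K\<^esub> u \<otimes>\<^bsub>K\<^esub> w)) (inv\<^bsub>H\<^esub> f \<otimes>\<^bsub>H\<^esub> g))"
    proof (intro sum.cong refl)
      fix f assume "f \<in> F"
      then have f: "f \<in> carrier H" using F by blast
      have "inv\<^bsub>K \<times>\<times> H\<^esub> (u, f) = (inv\<^bsub>K\<^esub> u, inv\<^bsub>H\<^esub> f)"
        by (rule inv_DirProd[OF K.is_group H.is_group u f])
      then show "indicator A (inv\<^bsub>K \<times>\<times> H\<^esub> (u, f) \<otimes>\<^bsub>K \<times>\<times> H\<^esub> (w, g))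
          = (indicator (?S (inv\<^bsub>K\<^esub> u \<otimes>\<^bsub>K\<^esub> w)) (inv\<^bsub>H\<^esub> f \<otimes>\<^bsub>H\<^esub> g) :: int)"
        using f g by (simp add: indicator_def)
    qed
    finally show ?thesis .
  qed
  have "tiling (K \<times>\<times> H) ({u} \<times> F) A \<longleftrightarrow> (\<forall>w\<in>carrier K. \<forall>g\<in>carrier H.
      (\<Sum>f\<in>{u} \<times> F. indicator A (inv\<^bsub>K \<times>\<times> H\<^esub> f \<otimes>\<^bsub>K \<times>\<times> H\<^esub> (w, g))) = (1 :: int))"
    by (subst KH.tiling_iff_sum) (use u F A in auto)
  also have "\<dots> \<longleftrightarrow> (\<forall>w\<in>carrier K. \<forall>g\<in>carrier H.
      (\<Sum>f\<in>F. indicator (?S (inv\<^bsub>K\<^esub> u \<otimes>\<^bsub>K\<^esub> w)) (inv\<^bsub>H\<^esub> f \<otimes>\<^bsub>H\<^esub> g)) = (1 :: int))"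
    by (intro ball_cong refl) (simp only: fibre_sum)
  also have "\<dots> \<longleftrightarrow> (\<forall>w\<in>carrier K. tiling H F (?S (inv\<^bsub>K\<^esub> u \<otimes>\<^bsub>K\<^esub> w)))"
    by (intro ball_cong refl H.tiling_iff_sum[symmetric] F) auto
  also have "\<dots> \<longleftrightarrow> (\<forall>v\<in>carrier K. tiling H F (?S v))"
  proof
    assume L: "\<forall>w\<in>carrier K. tiling H F (?S (inv\<^bsub>K\<^esub> u \<otimes>\<^bsub>K\<^esub> w))"
    show "\<forall>v\<in>carrier K. tiling H F (?S v)"
    proof
      fix v assume v: "v \<in> carrier K"
      then have "inv\<^bsub>K\<^esub> u \<otimes>\<^bsub>K\<^esub> (u \<otimes>\<^bsub>K\<^esub> v) = v"
        using u by (simp add: K.m_assoc[symmetric])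
      then show "tiling H F (?S v)" using L u v by (metis K.m_closed)
    qed
  qed (use u in auto)
  finally show ?thesis .
qed

section \<open>Almost sure properties of iid uniform variables\<close>

text \<open>
  The variables \<open>lam x\<close> may leave \<open>[0,1]\<close> on a null set, while the equivariant map of a factor is
  measurable only on \<open>[0,1]\<^sup>G\<close>. Clamping the values to \<open>[0,1]\<close> gives variables for which the law of the whole
  family can be formed on that space.
\<close>

lemma iid_uniform_unit_interval_version:
  assumes iid: "iid_uniform M I lam" and I: "countable I"
  defines "R \<equiv> restrict_space borel {0..1 :: real}"
  obtains lam' where "prob_space.indep_vars M (\<lambda>_. R) lam' I"
    and "\<And>x y. x \<in> I \<Longrightarrow> y \<in> I \<Longrightarrow> distr M R (lam' x) = distr M R (lam' y)"
    and "AE w in M. \<forall>x\<in>I. lam' x w = lam x w"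
proof
  interpret prob_space M using iid by (simp add: iid_uniform_def)
  define clamp where "clamp t = max 0 (min 1 t)" for t :: real
  have clamp: "clamp \<in> borel \<rightarrow>\<^sub>M R"
    unfolding R_def clamp_def by (intro measurable_restrict_space2) auto
  have indep: "indep_vars (\<lambda>_. borel) lam I"
    and law: "\<And>x. x \<in> I \<Longrightarrow> distr M borel (lam x) = uniform_measure lborel {0..1}"
    using iid by (simp_all add: iid_uniform_def)
  have rv: "random_variable borel (lam x)" if "x \<in> I" for x
    using indep that by (simp add: indep_vars_def)
  show "indep_vars (\<lambda>_. R) (\<lambda>x w. clamp (lam x w)) I"
    by (rule indep_vars_compose2[OF indep clamp])
  have "distr M R (\<lambda>w. clamp (lam x w)) = distr (uniform_measure lborel {0..1}) R clamp" if "x \<in> I" for x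
    using distr_distr[OF clamp rv[OF that]] law[OF that] by (simp add: comp_def)
  then show "distr M R (\<lambda>w. clamp (lam x w)) = distr M R (\<lambda>w. clamp (lam y w))"
    if "x \<in> I" "y \<in> I" for x y using that by simp
  have "AE w in M. clamp (lam x w) = lam x w" if x: "x \<in> I" for x
  proof -
    have "AE t in uniform_measure lborel {0..1}. clamp t = t"
      by (intro AE_uniform_measureI) (auto simp: clamp_def)
    then have "AE t in distr M borel (lam x). clamp t = t" by (simp only: law[OF x])
    then show ?thesis by (rule AE_distrD[OF rv[OF x]])
  qed
  then show "AE w in M. \<forall>x\<in>I. clamp (lam x w) = lam x w"
    using I by (simp add: AE_ball_countable)
qed

text \<open>
  Each pair of variables has the product of two atomless measures as its law, and this product does not charge
  the diagonal.
\<close>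

lemma iid_uniform_distinct:
  assumes iid: "iid_uniform M I lam" and I: "countable I"
  shows "AE w in M. \<forall>x\<in>I. \<forall>y\<in>I. x \<noteq> y \<longrightarrow> lam x w \<noteq> lam y w"
proof -
  interpret prob_space M using iid by (simp add: iid_uniform_def)
  let ?U = "uniform_measure lborel {0..1 :: real}"
  interpret U: prob_space ?U by (intro prob_space_uniform_measure) auto
  interpret UU: pair_sigma_finite ?U ?U ..
  have indep: "indep_vars (\<lambda>_. borel) lam I"
    and law: "\<And>x. x \<in> I \<Longrightarrow> distr M borel (lam x) = ?U"
    using iid by (simp_all add: iid_uniform_def)
  have diag: "AE p in ?U \<Otimes>\<^sub>M ?U. fst p \<noteq> snd p"
  proof (rule UU.AE_pair_measure)
    have "{p \<in> space (borel \<Otimes>\<^sub>M borel). fst p \<noteq> (snd p :: real)} \<in> sets (borel \<Otimes>\<^sub>M borel)"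
      by measurable
    moreover have "sets (?U \<Otimes>\<^sub>M ?U) = sets (borel \<Otimes>\<^sub>M borel)"
      by (intro sets_pair_measure_cong) simp_all
    moreover from this have "space (?U \<Otimes>\<^sub>M ?U) = space (borel \<Otimes>\<^sub>M borel)"
      by (rule sets_eq_imp_space_eq)
    ultimately show "{p \<in> space (?U \<Otimes>\<^sub>M ?U). fst p \<noteq> snd p} \<in> sets (?U \<Otimes>\<^sub>M ?U)"
      by (simp only:)
    have "AE t in ?U. s \<noteq> t" for s
      by (rule AE_uniform_measureI) (use AE_lborel_singleton[of s] in \<open>auto elim: eventually_mono\<close>)
    then show "AE s in ?U. AE t in ?U. fst (s, t) \<noteq> snd (s, t)" by simp
  qed
  have "AE w in M. lam x w \<noteq> lam y w" if xy: "x \<in> I" "y \<in> I" "x \<noteq> y" for x y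
  proof -
    have "indep_var (PiM {x} (\<lambda>_. borel)) (\<lambda>w. \<lambda>i\<in>{x}. lam i w) (PiM {y} (\<lambda>_. borel)) (\<lambda>w. \<lambda>i\<in>{y}. lam i w)"
      by (rule indep_var_restrict[OF indep]) (use xy in auto)
    then have "indep_var borel ((\<lambda>f. f x) \<circ> (\<lambda>w. \<lambda>i\<in>{x}. lam i w)) borel ((\<lambda>f. f y) \<circ> (\<lambda>w. \<lambda>i\<in>{y}. lam i w))"
      by (rule indep_var_compose) auto
    then have iv: "indep_var borel (lam x) borel (lam y)" by (simp add: comp_def)
    then have pair: "distr M (borel \<Otimes>\<^sub>M borel) (\<lambda>w. (lam x w, lam y w)) = ?U \<Otimes>\<^sub>M ?U"
      unfolding indep_var_distribution_eq law[OF xy(1)] law[OF xy(2)] by simp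
    have "AE p in distr M (borel \<Otimes>\<^sub>M borel) (\<lambda>w. (lam x w, lam y w)). fst p \<noteq> snd p"
      unfolding pair by (rule diag)
    from AE_distrD[OF measurable_Pair[OF indep_var_rv1[OF iv] indep_var_rv2[OF iv]] this]
    show ?thesis by simp
  qed
  then have "AE w in M. x \<noteq> y \<longrightarrow> lam x w \<noteq> lam y w" if "x \<in> I" "y \<in> I" for x y
    using that by (cases "x = y") auto
  then show ?thesis using I by (simp add: AE_ball_countable)
qed

section \<open>Tiles of factor of iid tilings lie in a single torsion coset\<close>

text \<open>
  Let \<open>p > card F\<close> be prime. By dilation, almost surely exactly one \<open>f \<in> F\<close> satisfies \<open>- p\<^sup>k f \<in> A\<close>, for each
  \<open>k\<close>; so for distinct elements \<open>f\<close> and \<open>f'\<close> of \<open>F\<close> the events \<open>- p\<^sup>k f \<in> A\<close> and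
  \<open>- p\<^sup>k f' \<in> A\<close> are disjoint up to a null set. Each has the same probability \<open>q\<close>, which is positive because
  translates of \<open>A\<close> cover \<open>G\<close>. By mixing, the joint probability \<open>0\<close> can only be this far from \<open>q\<^sup>2\<close> if the
  two shifts of a fixed finite set \<open>J\<close> meet, that is, if \<open>p\<^sup>k (f' - f)\<close> lies in the finite set
  \<open>J - J\<close>. This holds for all \<open>k\<close>, so two of these multiples coincide and \<open>f' - f\<close> has finite order.
\<close>

lemma factor_of_iid_tile_differences_torsion:
  assumes "comm_group G" "countable (carrier G)" and iid: "iid_uniform M (carrier G) lam"
    and A: "factor_of_iid_tiling M G lam F A"
    and F: "F \<subseteq> carrier G" "finite F" and f: "f \<in> F" "f' \<in> F" "f \<noteq> f'"
  shows "\<exists>n>0. f [^]\<^bsub>G\<^esub> n = f' [^]\<^bsub>G\<^esub> (n :: nat)"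
proof -
  interpret comm_group G by fact
  interpret prob_space M using iid by (simp add: iid_uniform_def)
  let ?R = "restrict_space borel {0..1 :: real}"
  obtain lam' where indep: "indep_vars (\<lambda>_. ?R) lam' (carrier G)"
    and same: "\<And>x y. x \<in> carrier G \<Longrightarrow> y \<in> carrier G \<Longrightarrow> distr M ?R (lam' x) = distr M ?R (lam' y)"
    and eq: "AE w in M. \<forall>x\<in>carrier G. lam' x w = lam x w"
    by (rule iid_uniform_unit_interval_version[OF iid assms(2)]) (rule that; assumption)
  define U where "U = distr M ?R (lam' \<one>\<^bsub>G\<^esub>)"
  have rv: "random_variable ?R (lam' x)" if "x \<in> carrier G" for x
    using indep that by (simp add: indep_vars_def)
  interpret U: prob_space U unfolding U_def by (intro prob_space_distr rv) simp
  have setsU: "sets U = sets ?R" by (simp add: U_def)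
  have indepU: "indep_vars (\<lambda>_. U) lam' (carrier G)"
    using indep_vars_compose2[OF indep, of "\<lambda>_ x. x" "\<lambda>_. U"]
    by (simp add: measurable_ident_sets setsU)
  have lawU: "distr M U (lam' x) = U" if "x \<in> carrier G" for x
  proof -
    have "distr M U (lam' x) = distr M ?R (lam' x)" by (intro distr_cong setsU refl)
    also have "\<dots> = U" unfolding U_def by (rule same[OF that one_closed])
    finally show ?thesis .
  qed
  let ?P = "\<Pi>\<^sub>M x\<in>carrier G. U"
  define L where "L g w = (\<lambda>x\<in>carrier G. lam' (g \<otimes>\<^bsub>G\<^esub> x) w)" for g w
  have rvU: "random_variable U (lam' x)" if "x \<in> carrier G" for x
    using rv[OF that] unfolding measurable_cong_sets[OF refl setsU] .
  have mL: "L g \<in> M \<rightarrow>\<^sub>M ?P" if "g \<in> carrier G" for g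
    unfolding L_def by (intro measurable_restrict rvU m_closed that)
  obtain \<Phi> where \<Phi>: "\<Phi> \<in> (\<Pi>\<^sub>M x\<in>carrier G. ?R) \<rightarrow>\<^sub>M count_space {0, 1 :: nat}"
    and fac: "AE w in M. \<forall>x0\<in>carrier G. indicator (A w) x0 = \<Phi> (\<lambda>x\<in>carrier G. lam (x0 \<otimes>\<^bsub>G\<^esub> x) w)"
    using A unfolding factor_of_iid_tiling_def factor_of_iid_def
    by (elim conjE bexE) (rule that; assumption)
  have "sets ?P = sets (\<Pi>\<^sub>M x\<in>carrier G. ?R)" by (intro sets_PiM_cong setsU refl)
  from measurable_cong_sets[OF this refl] have \<Phi>U: "\<Phi> \<in> ?P \<rightarrow>\<^sub>M count_space {0, 1}"
    using \<Phi> by (rule equalityD2[THEN subsetD])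
  define E where "E = \<Phi> -` {1} \<inter> space ?P"
  have E: "E \<in> sets ?P" unfolding E_def by (rule measurable_sets[OF \<Phi>U]) auto
  define q where "q = measure ?P E"
  have q: "prob (L g -` E \<inter> space M) = q" if "g \<in> carrier G" for g
    using measure_distr[OF mL[OF that] E]
      distr_shift_iid[OF prob_space_axioms is_group U.prob_space_axioms indepU lawU that, folded L_def]
    by (simp add: q_def)
  have AE_mem: "AE w in M. \<forall>g\<in>carrier G. g \<in> A w \<longleftrightarrow> L g w \<in> E"
    using fac eq AE_space
  proof eventually_elim
    case (elim w)
    show ?case
    proof
      fix g assume g: "g \<in> carrier G"
      have "(\<lambda>x\<in>carrier G. lam (g \<otimes>\<^bsub>G\<^esub> x) w) = L g w"
        unfolding L_def using g elim(2) by (intro restrict_ext) simp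
      then have "indicator (A w) g = \<Phi> (L g w)" using elim(1) g by simp
      moreover have "L g w \<in> space ?P" using measurable_space[OF mL[OF g] elim(3)] .
      ultimately show "g \<in> A w \<longleftrightarrow> L g w \<in> E" 
        by (cases "g \<in> A w") (auto simp: E_def)
    qed
  qed
  have AE_tile: "AE w in M. tiling G F (A w)"
    using A by (simp add: factor_of_iid_tiling_def)
  have tile_sum: "(\<Sum>f\<in>F. indicator B (inv\<^bsub>G\<^esub> f \<otimes>\<^bsub>G\<^esub> x)) = (1 :: int)"
    if "tiling G F B" "x \<in> carrier G" for B x
    using tiling_iff_sum[OF F] that by (auto simp: tiling_def)
  have "q \<noteq> 0"
  proof
    assume "q = 0"
    have "AE w in M. L g w \<notin> E" if "g \<in> carrier G" for g
    proof -
      have "prob (L g -` E \<inter> space M) = 0" using q[OF that] \<open>q = 0\<close> by simp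
      moreover have "L g -` E \<inter> space M \<in> events" by (rule measurable_sets[OF mL[OF that] E])
      ultimately have "L g -` E \<inter> space M \<in> null_sets M" by (simp add: null_setsI emeasure_eq_measure)
      from AE_not_in[OF this] show ?thesis using AE_space by eventually_elim auto
    qed
    then have "AE w in M. \<forall>g\<in>carrier G. L g w \<notin> E"
      using assms(2) by (simp add: AE_ball_countable)
    then have "AE w in M. False"
      using AE_mem AE_tile
    proof eventually_elim
      case (elim w)
      then have "(\<Sum>f\<in>F. indicator (A w) (inv\<^bsub>G\<^esub> f \<otimes>\<^bsub>G\<^esub> \<one>\<^bsub>G\<^esub>)) = (0 :: int)"
        using F(1) by (intro sum.neutral) auto
      then show False using tile_sum[OF elim(3) one_closed] by simp
    qed
    then show False by simp
  qed
  then have "0 < q\<^sup>2" by simp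
  \<comment> \<open>The error is taken to be \<open>q\<^sup>2\<close> itself, so that the joint probability must be positive when the shifts of \<open>J\<close> are disjoint.\<close>
  from iid_mixing[OF prob_space_axioms is_group U.prob_space_axioms indepU lawU E this, folded L_def q_def]
  obtain J where J: "J \<subseteq> carrier G" "finite J"
    and mix: "\<And>g h. g \<in> carrier G \<Longrightarrow> h \<in> carrier G \<Longrightarrow> (g <#\<^bsub>G\<^esub> J) \<inter> (h <#\<^bsub>G\<^esub> J) = {} \<Longrightarrow>
      \<bar>prob {w \<in> space M. L g w \<in> E \<and> L h w \<in> E} - q\<^sup>2\<bar> < q\<^sup>2"
    by blast
  obtain p where p: "Factorial_Ring.prime p" "card F < p" using bigger_prime by blast
  have fG: "f \<in> carrier G" "f' \<in> carrier G" using f F by auto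
  let ?D = "(\<lambda>(i, j). i \<otimes>\<^bsub>G\<^esub> inv\<^bsub>G\<^esub> j) ` (J \<times> J)"
  let ?c = "f' \<otimes>\<^bsub>G\<^esub> inv\<^bsub>G\<^esub> f"
  have "?c [^]\<^bsub>G\<^esub> (p ^ k) \<in> ?D" for k
  proof -
    define g h where "g = inv\<^bsub>G\<^esub> (f [^]\<^bsub>G\<^esub> (p ^ k))" and "h = inv\<^bsub>G\<^esub> (f' [^]\<^bsub>G\<^esub> (p ^ k))"
    have gh: "g \<in> carrier G" "h \<in> carrier G" using fG by (simp_all add: g_def h_def)
    have "AE w in M. \<not> (L g w \<in> E \<and> L h w \<in> E)"
      using AE_mem AE_tile
    proof eventually_elim
      case (elim w)
      have "(\<Sum>f\<in>F. indicator (A w) (inv\<^bsub>G\<^esub> (f [^]\<^bsub>G\<^esub> (p ^ k)) \<otimes>\<^bsub>G\<^esub> \<one>\<^bsub>G\<^esub>)) = (1 :: int)"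
        by (rule dilate_prime_power[OF F(2) p])
          (use F(1) tile_sum[OF elim(2)] in \<open>auto simp: indicator_def\<close>)
      moreover have "(\<Sum>f\<in>{f, f'}. indicator (A w) (inv\<^bsub>G\<^esub> (f [^]\<^bsub>G\<^esub> (p ^ k)) \<otimes>\<^bsub>G\<^esub> \<one>\<^bsub>G\<^esub>)) \<le>
          (\<Sum>f\<in>F. indicator (A w) (inv\<^bsub>G\<^esub> (f [^]\<^bsub>G\<^esub> (p ^ k)) \<otimes>\<^bsub>G\<^esub> \<one>\<^bsub>G\<^esub>) :: int)"
        using f by (intro sum_mono2 F(2)) auto
      ultimately have "indicator (A w) g + indicator (A w) h \<le> (1 :: int)"
        using f(3) gh by (simp add: g_def h_def)
      then have "\<not> (g \<in> A w \<and> h \<in> A w)" by (auto simp: indicator_def)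
      then show ?case using elim(1) gh by blast
    qed
    then have "prob {w \<in> space M. L g w \<in> E \<and> L h w \<in> E} = 0"
      by (rule prob_eq_0_AE)
    then have "(g <#\<^bsub>G\<^esub> J) \<inter> (h <#\<^bsub>G\<^esub> J) \<noteq> {}"
      using mix[OF gh] by auto
    then obtain i j where ij: "i \<in> J" "j \<in> J" "g \<otimes>\<^bsub>G\<^esub> i = h \<otimes>\<^bsub>G\<^esub> j"
      by (auto simp: l_coset_def)
    then have ijG: "i \<in> carrier G" "j \<in> carrier G" using J by auto
    have "?c [^]\<^bsub>G\<^esub> (p ^ k) = inv\<^bsub>G\<^esub> h \<otimes>\<^bsub>G\<^esub> g"
      using fG by (simp add: g_def h_def nat_pow_distrib nat_pow_inv)
    also have "\<dots> = inv\<^bsub>G\<^esub> h \<otimes>\<^bsub>G\<^esub> (g \<otimes>\<^bsub>G\<^esub> i) \<otimes>\<^bsub>G\<^esub> inv\<^bsub>G\<^esub> i"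
      using gh ijG by (simp add: m_assoc)
    also have "\<dots> = j \<otimes>\<^bsub>G\<^esub> inv\<^bsub>G\<^esub> i"
      unfolding ij(3) using gh ijG by (simp add: m_assoc[symmetric])
    finally show ?thesis using ij by auto
  qed
  then have "range (\<lambda>k. ?c [^]\<^bsub>G\<^esub> (p ^ k)) \<subseteq> ?D" by blast
  moreover have "finite ?D" using J(2) by simp
  ultimately have "finite (range (\<lambda>k. ?c [^]\<^bsub>G\<^esub> (p ^ k)))" by (rule finite_subset)
  then have "\<not> inj (\<lambda>k. ?c [^]\<^bsub>G\<^esub> (p ^ k))"
    using finite_imageD infinite_UNIV_nat by blast
  then obtain k l where kl: "k < l" "?c [^]\<^bsub>G\<^esub> (p ^ k) = ?c [^]\<^bsub>G\<^esub> (p ^ l)"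
    unfolding inj_def by (metis linorder_neqE_nat)
  define n where "n = p ^ l - p ^ k"
  have "p ^ k < p ^ l" using kl(1) prime_gt_1_nat[OF p(1)] by simp
  then have n: "0 < n" "p ^ l = n + p ^ k" by (simp_all add: n_def)
  have cG: "?c \<in> carrier G" using fG by simp
  have "?c [^]\<^bsub>G\<^esub> n \<otimes>\<^bsub>G\<^esub> ?c [^]\<^bsub>G\<^esub> (p ^ k) = ?c [^]\<^bsub>G\<^esub> (p ^ k)"
    unfolding nat_pow_mult[OF cG] n(2)[symmetric] by (rule kl(2)[symmetric])
  then have c1: "?c [^]\<^bsub>G\<^esub> n = \<one>\<^bsub>G\<^esub>" using cG by (simp add: r_cancel_one')
  have "f' = ?c \<otimes>\<^bsub>G\<^esub> f" using fG by (simp add: m_assoc)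
  then have "f' [^]\<^bsub>G\<^esub> n = ?c [^]\<^bsub>G\<^esub> n \<otimes>\<^bsub>G\<^esub> f [^]\<^bsub>G\<^esub> n"
    using nat_pow_distrib[OF cG fG(1)] by simp
  then show ?thesis using c1 fG n(1) by auto
qed

section \<open>Constructing a factor of iid tiling from a tile in one fibre\<close>

lemma sets_Collect_strict_argmin:
  fixes g :: "'i \<Rightarrow> 'x \<Rightarrow> real"
  assumes S: "finite S" and g: "\<And>h. h \<in> S \<Longrightarrow> g h \<in> borel_measurable N"
  shows "{y \<in> space N. \<exists>h\<in>S. B h \<and> (\<forall>k\<in>S - {h}. g h y < g k y)} \<in> sets N"
proof -
  have "{y \<in> space N. g h y < g k y} \<in> sets N" if "h \<in> S" "k \<in> S" for h k
    using that by (intro borel_measurable_less g)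
  then show ?thesis
    using S by (intro sets.sets_Collect_finite_Ex sets.sets_Collect_conj sets.sets_Collect_const
        sets.sets_Collect_finite_All) auto
qed

text \<open>
  Place in each fibre a translate of \<open>A0\<close>. The translate must be chosen equivariantly, without
  singling out a point of the fibre in advance: it is the translate by the position \<open>h\<close> of the smallest
  label in the fibre, which is almost surely unique.
\<close>

lemma single_fibre_factor_of_iid_tiling:
  fixes K :: "('a, 'b) monoid_scheme" and H :: "('c, 'd) monoid_scheme"
  assumes "comm_group K" "comm_group H"
    and K: "countable (carrier K)" and H: "finite (carrier H)"
    and iid: "iid_uniform M (carrier (K \<times>\<times> H)) lam"
    and u: "u \<in> carrier K" and A0: "tiling H F0 A0"
  shows "\<exists>A. factor_of_iid_tiling M (K \<times>\<times> H) lam ({u} \<times> F0) A"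
proof -
  interpret K: comm_group K by fact
  interpret H: comm_group H by fact
  interpret prob_space M using iid by (simp add: iid_uniform_def)
  let ?G = "K \<times>\<times> H"
  have F0: "F0 \<subseteq> carrier H" "finite F0"
    using A0 H finite_subset by (auto simp: tiling_def)
  \<comment> \<open>Existence of a strict minimum of the labels \<open>snd y\<close> on the fibre over \<open>v\<close>, at a position allowed by \<open>fst y\<close>.
      With ties there is no such position and \<open>A\<close> misses the fibre, which happens with probability \<open>0\<close>.\<close>
  define Q where "Q v y \<longleftrightarrow> (\<exists>h\<in>carrier H. fst y h \<and> (\<forall>k\<in>carrier H - {h}. snd y (v, h) < (snd y (v, k) :: real)))"
    for v :: 'a and y :: "('c \<Rightarrow> bool) \<times> ('a \<times> 'c \<Rightarrow> real)"
  define A where "A w = {(v, g). v \<in> carrier K \<and> g \<in> carrier H \<and>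
    Q v (\<lambda>h. inv\<^bsub>H\<^esub> h \<otimes>\<^bsub>H\<^esub> g \<in> A0, \<lambda>x. lam x w)}" for w
  let ?R = "restrict_space borel {0..1 :: real}"
  let ?P = "\<Pi>\<^sub>M x\<in>carrier ?G. ?R"
  define \<Phi> :: "('a \<times> 'c \<Rightarrow> real) \<Rightarrow> nat"
    where "\<Phi> y = (if Q \<one>\<^bsub>K\<^esub> (\<lambda>h. inv\<^bsub>H\<^esub> h \<in> A0, y) then 1 else 0)" for y
  have rv: "random_variable borel (lam x)" if "x \<in> carrier ?G" for x
    using iid that prob_space_axioms by (auto simp: iid_uniform_def indep_vars_def)
  have "random_subset M (carrier ?G) A"
    unfolding random_subset_def
  proof (intro conjI ballI)
    show "A w \<subseteq> carrier ?G" for w by (auto simp: A_def)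
    fix x assume x: "x \<in> carrier ?G"
    have "{w \<in> space M. Q (fst x) (\<lambda>h. inv\<^bsub>H\<^esub> h \<otimes>\<^bsub>H\<^esub> snd x \<in> A0, \<lambda>x. lam x w)} \<in> events"
      unfolding Q_def fst_conv snd_conv by (intro sets_Collect_strict_argmin H rv) (use x in auto)
    moreover have "x \<in> A w \<longleftrightarrow> Q (fst x) (\<lambda>h. inv\<^bsub>H\<^esub> h \<otimes>\<^bsub>H\<^esub> snd x \<in> A0, \<lambda>x. lam x w)" for w
      using x by (auto simp: A_def)
    ultimately show "{w \<in> space M. x \<in> A w} \<in> events" by simp
  qed
  moreover have "\<Phi> \<in> ?P \<rightarrow>\<^sub>M count_space {0, 1}"
  proof -
    have comp: "(\<lambda>y. y (\<one>\<^bsub>K\<^esub>, h)) \<in> borel_measurable ?P" if "h \<in> carrier H" for h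
    proof -
      have "(\<lambda>y. y (\<one>\<^bsub>K\<^esub>, h)) \<in> ?P \<rightarrow>\<^sub>M ?R"
        using that by (intro measurable_component_singleton) simp
      then show ?thesis by (simp add: measurable_restrict_space2_iff)
    qed
    have "{y \<in> space ?P. Q \<one>\<^bsub>K\<^esub> (\<lambda>h. inv\<^bsub>H\<^esub> h \<in> A0, y)} \<in> sets ?P"
      unfolding Q_def fst_conv snd_conv by (intro sets_Collect_strict_argmin H comp)
    then show ?thesis
      unfolding \<Phi>_def by (intro measurable_If measurable_const) auto
  qed
  moreover have "AE w in M. \<forall>x0\<in>carrier ?G. indicator (A w) x0 = \<Phi> (\<lambda>x\<in>carrier ?G. lam (x0 \<otimes>\<^bsub>?G\<^esub> x) w)"
  proof (intro AE_I2 ballI)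
    fix w x0 assume x0: "x0 \<in> carrier ?G"
    show "indicator (A w) x0 = \<Phi> (\<lambda>x\<in>carrier ?G. lam (x0 \<otimes>\<^bsub>?G\<^esub> x) w)"
    proof -
      obtain v g where vg: "x0 = (v, g)" "v \<in> carrier K" "g \<in> carrier H" using x0 by auto
      let ?y = "\<lambda>x\<in>carrier ?G. lam (x0 \<otimes>\<^bsub>?G\<^esub> x) w"
      have y: "?y (\<one>\<^bsub>K\<^esub>, h) = lam (v, g \<otimes>\<^bsub>H\<^esub> h) w" if "h \<in> carrier H" for h
        using that vg by simp
      have "x0 \<in> A w \<longleftrightarrow> (\<exists>h\<in>carrier H. inv\<^bsub>H\<^esub> h \<otimes>\<^bsub>H\<^esub> g \<in> A0 \<and>
          (\<forall>k\<in>carrier H - {h}. lam (v, h) w < lam (v, k) w))"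
        using vg by (simp add: A_def Q_def)
      \<comment> \<open>Equivariance: seen from \<open>g\<close>, the minimum at \<open>h\<close> sits at \<open>h - g\<close>.\<close>
    also have "\<dots> \<longleftrightarrow> (\<exists>h\<in>carrier H. inv\<^bsub>H\<^esub> h \<in> A0 \<and>
          (\<forall>k\<in>carrier H - {h}. lam (v, g \<otimes>\<^bsub>H\<^esub> h) w < lam (v, g \<otimes>\<^bsub>H\<^esub> k) w))"
      proof
        assume "\<exists>h\<in>carrier H. inv\<^bsub>H\<^esub> h \<otimes>\<^bsub>H\<^esub> g \<in> A0 \<and>
          (\<forall>k\<in>carrier H - {h}. lam (v, h) w < lam (v, k) w)"
        then obtain h where h: "h \<in> carrier H" "inv\<^bsub>H\<^esub> h \<otimes>\<^bsub>H\<^esub> g \<in> A0"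
          and less: "\<And>k. k \<in> carrier H \<Longrightarrow> k \<noteq> h \<Longrightarrow> lam (v, h) w < lam (v, k) w" by blast
        let ?h = "inv\<^bsub>H\<^esub> g \<otimes>\<^bsub>H\<^esub> h"
        have "inv\<^bsub>H\<^esub> ?h = inv\<^bsub>H\<^esub> h \<otimes>\<^bsub>H\<^esub> g" using h vg by (simp add: H.inv_mult_group)
        moreover have gh: "g \<otimes>\<^bsub>H\<^esub> ?h = h" using h vg by (simp add: H.m_assoc[symmetric])
        moreover have "lam (v, h) w < lam (v, g \<otimes>\<^bsub>H\<^esub> k) w" if k: "k \<in> carrier H" "k \<noteq> ?h" for k
        proof (rule less)
          show "g \<otimes>\<^bsub>H\<^esub> k \<noteq> h"
          proof
            assume "g \<otimes>\<^bsub>H\<^esub> k = h"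
            then have "?h = k" using k(1) vg by (auto simp: H.m_assoc[symmetric])
            then show False using k(2) by simp
          qed
        qed (use k vg in simp)
        moreover have "?h \<in> carrier H" using h vg by simp
        ultimately show "\<exists>h\<in>carrier H. inv\<^bsub>H\<^esub> h \<in> A0 \<and>
          (\<forall>k\<in>carrier H - {h}. lam (v, g \<otimes>\<^bsub>H\<^esub> h) w < lam (v, g \<otimes>\<^bsub>H\<^esub> k) w)"
          using h(2) by (intro bexI[of _ ?h]) auto
      next
        assume "\<exists>h\<in>carrier H. inv\<^bsub>H\<^esub> h \<in> A0 \<and>
          (\<forall>k\<in>carrier H - {h}. lam (v, g \<otimes>\<^bsub>H\<^esub> h) w < lam (v, g \<otimes>\<^bsub>H\<^esub> k) w)"
        then obtain h where h: "h \<in> carrier H" "inv\<^bsub>H\<^esub> h \<in> A0"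
          and less: "\<And>k. k \<in> carrier H \<Longrightarrow> k \<noteq> h \<Longrightarrow> lam (v, g \<otimes>\<^bsub>H\<^esub> h) w < lam (v, g \<otimes>\<^bsub>H\<^esub> k) w"
          by blast
        let ?h = "g \<otimes>\<^bsub>H\<^esub> h"
        have "inv\<^bsub>H\<^esub> ?h \<otimes>\<^bsub>H\<^esub> g = inv\<^bsub>H\<^esub> h" using h vg by (simp add: H.inv_mult_group H.m_assoc)
        moreover have "lam (v, ?h) w < lam (v, k) w" if k: "k \<in> carrier H" "k \<noteq> ?h" for k
        proof -
          have gk: "g \<otimes>\<^bsub>H\<^esub> (inv\<^bsub>H\<^esub> g \<otimes>\<^bsub>H\<^esub> k) = k" using k vg by (simp add: H.m_assoc[symmetric])
          then have "inv\<^bsub>H\<^esub> g \<otimes>\<^bsub>H\<^esub> k \<noteq> h" using k(2) by auto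
          from less[OF _ this] show ?thesis using gk k vg by simp
        qed
        moreover have "?h \<in> carrier H" using h vg by simp
        ultimately show "\<exists>h\<in>carrier H. inv\<^bsub>H\<^esub> h \<otimes>\<^bsub>H\<^esub> g \<in> A0 \<and>
          (\<forall>k\<in>carrier H - {h}. lam (v, h) w < lam (v, k) w)"
          using h(2) by (intro bexI[of _ ?h]) auto
      qed
      also have "\<dots> \<longleftrightarrow> Q \<one>\<^bsub>K\<^esub> (\<lambda>h. inv\<^bsub>H\<^esub> h \<in> A0, ?y)"
        unfolding Q_def fst_conv snd_conv by (intro bex_cong conj_cong ball_cong refl) (simp only: y Diff_iff)
      finally show ?thesis by (simp add: \<Phi>_def)
    qed
  qed
  moreover have "AE w in M. tiling ?G ({u} \<times> F0) (A w)"
  proof -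
    have "countable (carrier ?G)" using K H by (simp add: countable_finite)
    from iid_uniform_distinct[OF iid this] show ?thesis
    proof eventually_elim
      case (elim w)
      have "tiling H F0 {g \<in> carrier H. (v, g) \<in> A w}" if v: "v \<in> carrier K" for v
      proof -
        obtain h where h: "h \<in> carrier H" and le: "\<And>k. k \<in> carrier H \<Longrightarrow> lam (v, h) w \<le> lam (v, k) w"
          using ex_min_if_finite[of "(\<lambda>h. lam (v, h) w) ` carrier H"] H H.one_closed
          by (force simp: not_less)
        have less: "lam (v, h) w < lam (v, k) w" if "k \<in> carrier H" "k \<noteq> h" for k
          using le[OF that(1)] elim[THEN bspec, THEN bspec, of "(v, h)" "(v, k)"] that h v by simp
        have "Q v (\<lambda>h. inv\<^bsub>H\<^esub> h \<otimes>\<^bsub>H\<^esub> g \<in> A0, \<lambda>x. lam x w) \<longleftrightarrow> inv\<^bsub>H\<^esub> h \<otimes>\<^bsub>H\<^esub> g \<in> A0" for g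
        proof
          assume "Q v (\<lambda>h. inv\<^bsub>H\<^esub> h \<otimes>\<^bsub>H\<^esub> g \<in> A0, \<lambda>x. lam x w)"
          then obtain h' where h': "h' \<in> carrier H" "inv\<^bsub>H\<^esub> h' \<otimes>\<^bsub>H\<^esub> g \<in> A0"
            "\<forall>k\<in>carrier H - {h'}. lam (v, h') w < lam (v, k) w"
            by (auto simp: Q_def)
          have "h' = h"
          proof (rule ccontr)
            assume "h' \<noteq> h"
            then have "lam (v, h') w < lam (v, h) w" using h'(3) h by auto
            then show False using le[OF h'(1)] by simp
          qed
          then show "inv\<^bsub>H\<^esub> h \<otimes>\<^bsub>H\<^esub> g \<in> A0" using h'(2) by simp
        next
          assume "inv\<^bsub>H\<^esub> h \<otimes>\<^bsub>H\<^esub> g \<in> A0"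
          then show "Q v (\<lambda>h. inv\<^bsub>H\<^esub> h \<otimes>\<^bsub>H\<^esub> g \<in> A0, \<lambda>x. lam x w)"
            using h less by (auto simp: Q_def)
        qed
        then have "{g \<in> carrier H. (v, g) \<in> A w} = {g \<in> carrier H. inv\<^bsub>H\<^esub> h \<otimes>\<^bsub>H\<^esub> g \<in> A0}"
          using v by (simp add: A_def)
        then show ?thesis using H.tiling_translate[OF A0 F0(2) h] by simp
      qed
      then show "tiling ?G ({u} \<times> F0) (A w)"
        by (subst tiling_single_fibre_iff[OF assms(1,2) u F0]) (auto simp: A_def)
    qed
  qed
  ultimately show ?thesis
    unfolding factor_of_iid_tiling_def factor_of_iid_def by (intro exI[of _ A] conjI bexI[of _ \<Phi>])
qed

section \<open>Characterization of the tiles of factor of iid tilings\<close>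

theorem theorem1p5:
  fixes d :: nat
    and G0 :: "'a monoid"
    and F :: "((nat \<Rightarrow> int) \<times> 'a) set"
    and M :: "'w measure"
    and lam :: "(nat \<Rightarrow> int) \<times> 'a \<Rightarrow> 'w \<Rightarrow> real"
  assumes "comm_group G0" and "finite (carrier G0)"
    and "F \<subseteq> carrier (lattice_group d \<times>\<times> G0)" and "finite F"
    and "iid_uniform M (carrier (lattice_group d \<times>\<times> G0)) lam"
  shows "(\<exists>A. factor_of_iid_tiling M (lattice_group d \<times>\<times> G0) lam F A) \<longleftrightarrow>
    (\<exists>x0 F0. x0 \<in> carrier (lattice_group d) \<and> F0 \<subseteq> carrier G0 \<and> F = {x0} \<times> F0 \<and>
      (\<exists>A0. A0 \<subseteq> carrier G0 \<and> tiling G0 F0 A0))"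
proof
  let ?L = "lattice_group d"
  let ?G = "?L \<times>\<times> G0"
  note L = comm_group_lattice_group[of d]
  note G = comm_group_DirProd[OF L assms(1)]
  interpret L: comm_group ?L by (rule L)
  interpret G: comm_group ?G by (rule G)
  interpret prob_space M using assms(5) by (simp add: iid_uniform_def)
  assume "\<exists>A. factor_of_iid_tiling M ?G lam F A"
  then obtain A where A: "factor_of_iid_tiling M ?G lam F A" by blast
  have countable: "countable (carrier ?G)"
    using assms(2) by (simp add: countable_lattice_group countable_finite)
  have "AE w in M. tiling ?G F (A w)" using A by (simp add: factor_of_iid_tiling_def)
  then have "\<exists>w. tiling ?G F (A w)" by (rule contrapos_pp) simp
  then obtain w where w: "tiling ?G F (A w)" by blast
  have "F \<noteq> {}"
  proof
    assume "F = {}"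
    then have "carrier ?G = {}" using w by (simp add: tiling_def del: carrier_DirProd)
    then show False using G.one_closed by blast
  qed
  then obtain f where f: "f \<in> F" by blast
  have same: "fst f' = fst f" if f': "f' \<in> F" for f'
  proof (cases "f = f'")
    case False
    then obtain n :: nat where n: "0 < n" "f [^]\<^bsub>?G\<^esub> n = f' [^]\<^bsub>?G\<^esub> n"
      using factor_of_iid_tile_differences_torsion[OF G countable assms(5) A assms(3,4) f f'] by blast
    then have "fst f' [^]\<^bsub>?L\<^esub> n = fst f [^]\<^bsub>?L\<^esub> n" by (simp add: DirProd_pow)
    moreover have "fst f \<in> carrier ?L" "fst f' \<in> carrier ?L" using f f' assms(3) by auto
    ultimately show ?thesis using lattice_group_torsion_free n(1) by blast
  qed simp
  then have F: "F = {fst f} \<times> snd ` F" by force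
  have x0: "fst f \<in> carrier ?L" and F0: "snd ` F \<subseteq> carrier G0" using f assms(3) by auto
  have "A w \<subseteq> carrier ?G" using w by (simp add: tiling_def)
  moreover have "tiling ?G ({fst f} \<times> snd ` F) (A w)" using w F by simp
  ultimately have "tiling G0 (snd ` F) {g \<in> carrier G0. (\<one>\<^bsub>?L\<^esub>, g) \<in> A w}"
    using tiling_single_fibre_iff[OF L assms(1) x0 F0 finite_imageI[OF assms(4)]] L.one_closed by blast
  then show "\<exists>x0 F0. x0 \<in> carrier ?L \<and> F0 \<subseteq> carrier G0 \<and> F = {x0} \<times> F0 \<and>
      (\<exists>A0. A0 \<subseteq> carrier G0 \<and> tiling G0 F0 A0)"
    using x0 F0 F by (intro exI[of _ "fst f"] exI[of _ "snd ` F"] exI conjI) auto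
next
  assume "\<exists>x0 F0. x0 \<in> carrier (lattice_group d) \<and> F0 \<subseteq> carrier G0 \<and> F = {x0} \<times> F0 \<and>
      (\<exists>A0. A0 \<subseteq> carrier G0 \<and> tiling G0 F0 A0)"
  then obtain x0 F0 A0 where "x0 \<in> carrier (lattice_group d)" "F = {x0} \<times> F0" "tiling G0 F0 A0"
    by blast
  then show "\<exists>A. factor_of_iid_tiling M (lattice_group d \<times>\<times> G0) lam F A"
    using single_fibre_factor_of_iid_tiling[OF comm_group_lattice_group assms(1) countable_lattice_group assms(2,5)]
    by blast
qed

end
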